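(* Let $X$ be a space which is homeomorphic to a composant of an indecomposable continuum. Then $X$ cannot be embedded into a Suslinian continuum (that is, $X$ is not homeomorphic to a subspace of any Suslinian continuum). Moreover, every metrizable compactification of $X$ contains $\mathfrak c=|\mathbb R|$ pairwise disjoint dense semicontinua.
   Context: All spaces are separable and metrizable. A continuum is a compact connected metrizable space with more than one point; a subcontinuum is a subspace that is a continuum. A connected space is decomposable if it can be written as the union of two proper closed connected subsets, and otherwise it is indecomposable. A composant of a continuum $I$ is the union of all proper subcontinua of $I$ that contain a given point of $I$. A continuum is Suslinian if it contains no uncountable collection of pairwise disjoint subcontinua. A semicontinuum is a continuum-wise connected space, i.e. a space $S$ such that every two points of $S$ lie in a continuum contained in $S$. A compactification of $X$ is a compact space $\gamma X$ together with a homeomorphic embedding $\gamma:X\hookrightarrow\gamma X$ whose image is dense in $\gamma X$; a semicontinuum in $\gamma X$ is dense if it is a dense subset of $\gamma X$. *)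

theory Defs
  imports "HOL-Analysis.Analysis"
begin

definition sep_metrizable :: "'a topology \<Rightarrow> bool" where
  "sep_metrizable X \<longleftrightarrow> separable_space X \<and> metrizable_space X"

(* Separability is automatic for compact metrizable spaces.  Continua are nondegenerate. *)
definition continuum :: "'a topology \<Rightarrow> bool" where
  "continuum X \<longleftrightarrow> compact_space X \<and> connected_space X \<and> metrizable_space X \<and>
     (\<exists>x\<in>topspace X. \<exists>y\<in>topspace X. x \<noteq> y)"

definition subcontinuum :: "'a topology \<Rightarrow> 'a set \<Rightarrow> bool" where
  "subcontinuum X C \<longleftrightarrow> C \<subseteq> topspace X \<and> continuum (subtopology X C)"

definition decomposable :: "'a topology \<Rightarrow> bool" where
  "decomposable X \<longleftrightarrow> connected_space X \<and>
     (\<exists>A B. closedin X A \<and> connectedin X A \<and> A \<noteq> topspace X \<and>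
            closedin X B \<and> connectedin X B \<and> B \<noteq> topspace X \<and>
            A \<union> B = topspace X)"

definition indecomposable :: "'a topology \<Rightarrow> bool" where
  "indecomposable X \<longleftrightarrow> connected_space X \<and> \<not> decomposable X"

definition composant_of :: "'a topology \<Rightarrow> 'a \<Rightarrow> 'a set" where
  "composant_of X x = \<Union>{C. subcontinuum X C \<and> C \<noteq> topspace X \<and> x \<in> C}"

definition composant :: "'a topology \<Rightarrow> 'a set \<Rightarrow> bool" where
  "composant X P \<longleftrightarrow> (\<exists>x\<in>topspace X. P = composant_of X x)"

definition suslinian_continuum :: "'a topology \<Rightarrow> bool" where
  "suslinian_continuum X \<longleftrightarrow> continuum X \<and>
     \<not> (\<exists>\<C>. uncountable \<C> \<and> pairwise disjnt \<C> \<and> (\<forall>C\<in>\<C>. subcontinuum X C))"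

(* The two points are not required to be distinct.  This matters only for one-point spaces,
   which are not semicontinua here because continua are nondegenerate. *)
definition semicontinuum :: "'a topology \<Rightarrow> bool" where
  "semicontinuum S \<longleftrightarrow>
     (\<forall>x\<in>topspace S. \<forall>y\<in>topspace S. \<exists>C. subcontinuum S C \<and> x \<in> C \<and> y \<in> C)"

definition dense_semicontinuum_in :: "'a topology \<Rightarrow> 'a set \<Rightarrow> bool" where
  "dense_semicontinuum_in Y S \<longleftrightarrow>
     S \<subseteq> topspace Y \<and> semicontinuum (subtopology Y S) \<and> Y closure_of S = topspace Y"

definition compactification :: "'a topology \<Rightarrow> 'b topology \<Rightarrow> ('a \<Rightarrow> 'b) \<Rightarrow> bool" where
  "compactification X Y g \<longleftrightarrow>
     compact_space Y \<and> embedding_map X Y g \<and> Y closure_of (g ` topspace X) = topspace Y"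

end

theory Submission
  imports Defs
begin

text \<open>
  Composants of an indecomposable continuum \<open>I\<close> partition \<open>I\<close> into dense sets (boundary
  bumping), each a countable union of nowhere dense closed sets.  The claim about compactifications
  holds because a homeomorphism between a composant \<open>P\<close> and a dense subspace of \<open>Y\<close> cannot be
  confined to \<open>P\<close>: it automatically carries continuum many further composants along.

  By Lavrentiev's theorem, applied to the embedding and to its inverse, the embedding extends to a
  continuous injection of some \<open>G\<^sub>\<delta>\<close> set \<open>G \<supseteq> P\<close> into \<open>Y\<close>
  (\<open>embedding_extends_to_injective_gdelta\<close>).  The injective image of a composant \<open>Q \<subseteq> G\<close> is a
  dense semicontinuum of \<open>Y\<close>, and different composants have disjoint images.  It remains to find
  \<open>\<cc>\<close> composants inside \<open>G\<close>.

  The complement of \<open>G\<close> may meet every composant other than \<open>P\<close> a priori, but the union of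
  the composants that it meets is meager.  Lying in a common composant is an \<open>F\<^sub>\<sigma>\<close>
  relation on the compact space \<open>I\<close>: it is the union of the closed relations
  \<open>joined_off I U\<close>, with \<open>U\<close> ranging over a countable \<open>\<pi>\<close>-base.  So that union is a
  countable union of closed sets, all of them disjoint from the dense set \<open>P\<close> and hence nowhere
  dense (\<open>composants_leaving_gdelta_meager\<close>).  As composants are meager too, Baire's theorem yields
  infinitely many composants inside \<open>G\<close>.  A Cantor scheme whose centres are taken from
  different composants among these then gives \<open>\<cc>\<close> points with pairwise different composants
  inside \<open>G\<close> (\<open>Cantor_scheme_avoiding_relations\<close>, \<open>composants_inside_gdelta\<close>).

  If \<open>X\<close> were embedded in a Suslinian continuum, then the closure of its image would be a
  metrizable compactification of \<open>X\<close>.  Each of its \<open>\<cc>\<close> disjoint semicontinua contains a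
  continuum, which is absurd.
\<close>

section \<open>Points joined by a continuum that misses an open set\<close>

lemma continuum_Hausdorff: "continuum I \<Longrightarrow> Hausdorff_space I"
  by (simp add: continuum_def metrizable_imp_Hausdorff_space)

lemma subcontinuum_iff:
  assumes "continuum I"
  shows "subcontinuum I C \<longleftrightarrow> closedin I C \<and> connectedin I C \<and> (\<exists>x\<in>C. \<exists>y\<in>C. x \<noteq> y)"
proof -
  have "compactin I C \<longleftrightarrow> closedin I C"
    using assms by (metis closedin_compact_space compactin_imp_closedin continuum_Hausdorff continuum_def)
  then show ?thesis
    using assms unfolding subcontinuum_def continuum_def connectedin_def
    by (metis closedin_subset compactin_subspace metrizable_space_subtopology topspace_subtopology_subset)
qed

text \<open>
  For a continuum \<open>I\<close> and open \<open>U\<close>, these are the pairs of points that lie in a common closed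
  connected set disjoint from \<open>U\<close> (\<open>joined_off_iff\<close>).  Quasi-components agree with components in compact Hausdorff
  spaces; they are used here because they make it evident that the relation is closed.
\<close>
definition joined_off :: "'a topology \<Rightarrow> 'a set \<Rightarrow> ('a \<times> 'a) set" where
  "joined_off I U = {(x, y). quasi_component_of (subtopology I (topspace I - U)) x y}"

text \<open>
  Each clopen subset of the complement of \<open>U\<close> imposes a closed condition on the pair, and the
  relation is the conjunction of these conditions.
\<close>
lemma closedin_joined_off:
  assumes "openin I U"
  shows "closedin (prod_topology I I) (joined_off I U)"
proof -
  define Z where "Z = topspace I - U"
  have Z: "closedin I Z" "topspace I \<inter> Z = Z" using assms by (auto simp: Z_def)
  define \<T> where "\<T> = {T. closedin (subtopology I Z) T \<and> openin (subtopology I Z) T}"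
  have clo: "closedin I T" "closedin I (Z - T)" if "T \<in> \<T>" for T
    using that Z unfolding \<T>_def
    by (auto simp: closedin_closed_subtopology openin_closedin_eq)
  have eq: "joined_off I U = (Z \<times> Z) \<inter> (\<Inter>T\<in>\<T>. T \<times> T \<union> (Z - T) \<times> (Z - T))"
    unfolding joined_off_def quasi_component_of_def Z_def[symmetric] \<T>_def
    using Z by (auto simp: openin_closedin_eq)
  have "Z \<in> \<T>" using Z(1) closedin_subset[OF Z(1)] by (simp add: \<T>_def openin_subtopology_refl)
  then show ?thesis
    unfolding eq using Z clo
    by (intro closedin_Int closedin_Inter) (auto simp: closedin_prod_Times_iff)
qed

lemma joined_off_component:
  assumes "continuum I" "openin I U"
  shows "{y. (x, y) \<in> joined_off I U} = connected_component_of_set (subtopology I (topspace I - U)) x"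
proof -
  define S where "S = subtopology I (topspace I - U)"
  have "compact_space S" "Hausdorff_space S"
    using assms unfolding S_def
    by (simp_all add: closedin_compact_space compact_space_subtopology continuum_Hausdorff
        Hausdorff_space_subtopology continuum_def closedin_diff)
  then show ?thesis
    by (simp add: joined_off_def quasi_eq_connected_component_of flip: S_def)
qed

lemma joined_off_section:
  assumes "continuum I" "openin I U"
  shows "closedin I {y. (x, y) \<in> joined_off I U}" "connectedin I {y. (x, y) \<in> joined_off I U}"
    "{y. (x, y) \<in> joined_off I U} \<inter> U = {}"
proof -
  have clo: "closedin I (topspace I - U)" using assms(2) by blast
  define S where "S = subtopology I (topspace I - U)"
  define C where "C = connected_component_of_set S x"
  have "closedin S C" "connectedin S C"
    by (simp_all add: C_def closedin_connected_component_of connectedin_connected_component_of)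
  then have "closedin I C" "connectedin I C" "C \<inter> U = {}"
    unfolding S_def closedin_closed_subtopology[OF clo] connectedin_subtopology by auto
  then show "closedin I {y. (x, y) \<in> joined_off I U}" "connectedin I {y. (x, y) \<in> joined_off I U}"
    "{y. (x, y) \<in> joined_off I U} \<inter> U = {}"
    unfolding joined_off_component[OF assms] C_def S_def .
qed

lemma joined_off_iff:
  assumes "continuum I" "openin I U"
  shows "(x, y) \<in> joined_off I U \<longleftrightarrow>
    (\<exists>C. closedin I C \<and> connectedin I C \<and> C \<inter> U = {} \<and> x \<in> C \<and> y \<in> C)"
proof
  assume xy: "(x, y) \<in> joined_off I U"
  then have "(x, x) \<in> joined_off I U"
    by (auto simp: joined_off_def dest: quasi_component_in_topspace)
  with xy show "\<exists>C. closedin I C \<and> connectedin I C \<and> C \<inter> U = {} \<and> x \<in> C \<and> y \<in> C"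
    using joined_off_section[OF assms, of x]
    by (intro exI[of _ "{y. (x, y) \<in> joined_off I U}"]) simp
next
  assume "\<exists>C. closedin I C \<and> connectedin I C \<and> C \<inter> U = {} \<and> x \<in> C \<and> y \<in> C"
  then obtain C where C: "closedin I C" "connectedin I C" "C \<inter> U = {}" "x \<in> C" "y \<in> C"
    by blast
  then have "connectedin (subtopology I (topspace I - U)) C"
    unfolding connectedin_subtopology using closedin_subset by fastforce
  then have "y \<in> connected_component_of_set (subtopology I (topspace I - U)) x"
    using C unfolding connected_component_of_def by blast
  then show "(x, y) \<in> joined_off I U"
    unfolding joined_off_component[OF assms, symmetric] by simp
qed

lemma joined_off_mono: "\<lbrakk>continuum I; openin I U; openin I V; V \<subseteq> U\<rbrakk> \<Longrightarrow> joined_off I U \<subseteq> joined_off I V"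
  by (intro subrelI) (simp only: joined_off_iff, blast)

lemma joined_off_boundary_bumping:
  assumes I: "continuum I" and U: "openin I U" "U \<noteq> {}" and x: "x \<in> topspace I - U"
  obtains y where "y \<in> I closure_of U" "(x, y) \<in> joined_off I U"
proof -
  define S where "S = subtopology I (topspace I - U)"
  have clo: "closedin I (topspace I - U)" using U by blast
  define C where "C = connected_component_of_set S x"
  have xC: "x \<in> C" using x by (simp add: C_def S_def connected_component_of_refl)
  have "C \<in> connected_components_of S"
    using x by (simp add: C_def S_def connected_components_of_def)
  then have "C \<inter> I frontier_of (topspace I - U) \<noteq> {}"
    using I clo U unfolding S_def
    by (intro boundary_bumping_theorem_closed)
       (auto simp: continuum_Hausdorff continuum_def dest: openin_subset)
  then obtain y where y: "y \<in> C" "y \<in> I closure_of U"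
    using U by (metis Int_emptyI IntE double_diff frontier_of_closures openin_subset order_refl)
  have "(x, y) \<in> joined_off I U"
    using y(1) connected_component_subset_quasi_component_of[of S x]
    unfolding joined_off_def C_def S_def by blast
  with y that show thesis by blast
qed

section \<open>Composants of a continuum\<close>

text \<open>
  A closed connected set that joins \<open>x\<close> to another point is a subcontinuum.  That \<open>x\<close> itself
  belongs to its composant needs boundary bumping, because subcontinua are nondegenerate.
\<close>
lemma composant_of_eq_joined_off:
  assumes I: "continuum I" and x: "x \<in> topspace I"
  shows "composant_of I x = {y. \<exists>U. openin I U \<and> U \<noteq> {} \<and> (x, y) \<in> joined_off I U}"
    (is "_ = ?R")
proof (intro set_eqI iffI)
  fix y assume "y \<in> composant_of I x"
  then obtain C where C: "subcontinuum I C" "C \<noteq> topspace I" "x \<in> C" "y \<in> C"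
    unfolding composant_of_def by blast
  have "openin I (topspace I - C)" "topspace I - C \<noteq> {}" "C \<inter> (topspace I - C) = {}"
    using C closedin_subset unfolding subcontinuum_iff[OF I] by blast+
  moreover have "(x, y) \<in> joined_off I (topspace I - C)"
    unfolding joined_off_iff[OF I calculation(1)]
    using C(1) calculation(3) C(3,4) unfolding subcontinuum_iff[OF I] by blast
  ultimately show "y \<in> ?R"
    by blast
next
  have *: "y \<in> composant_of I x"
    if U: "openin I U" "U \<noteq> {}" and xy: "(x, y) \<in> joined_off I U" "x \<noteq> y" for y U
  proof -
    obtain C where C: "closedin I C" "connectedin I C" "C \<inter> U = {}" "x \<in> C" "y \<in> C"
      using xy unfolding joined_off_iff[OF I U(1)] by blast
    have "subcontinuum I C"
      unfolding subcontinuum_iff[OF I] using C xy by blast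
    moreover have "C \<noteq> topspace I"
      using C U openin_subset by blast
    ultimately show ?thesis
      using C by (auto simp: composant_of_def)
  qed
  fix y assume "y \<in> ?R"
  show "y \<in> composant_of I x"
  proof (cases "y = x")
    case False with \<open>y \<in> ?R\<close> * show ?thesis by blast
  next
    case True
    obtain z where z: "z \<in> topspace I" "z \<noteq> x"
      using I unfolding continuum_def by metis
    then obtain U V where UV: "openin I U" "openin I V" "z \<in> U" "x \<in> V" "disjnt U V"
      using continuum_Hausdorff[OF I] x unfolding Hausdorff_space_def by metis
    then have "x \<notin> I closure_of U"
      by (auto simp: in_closure_of disjnt_iff)
    moreover have "x \<in> topspace I - U"
      using UV x by (auto simp: disjnt_iff)
    ultimately obtain w where "w \<in> composant_of I x"
      using joined_off_boundary_bumping[OF I UV(1)] UV(1,3) * by (metis empty_iff)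
    then show ?thesis
      using True by (auto simp: composant_of_def)
  qed
qed

lemma composant_of_refl:
  assumes I: "continuum I" and x: "x \<in> topspace I"
  shows "x \<in> composant_of I x"
proof -
  obtain z where z: "z \<in> topspace I" "z \<noteq> x"
    using I unfolding continuum_def by metis
  have "openin I (topspace I - {x})"
    using I x by (simp add: closedin_Hausdorff_singleton continuum_Hausdorff openin_diff)
  moreover have "(x, x) \<in> joined_off I (topspace I - {x})"
    using x by (simp add: joined_off_def)
  ultimately show ?thesis
    using z composant_of_eq_joined_off[OF I x] by blast
qed

text \<open>
  To reach an open set \<open>W\<close> that misses \<open>x\<close>, remove a smaller open set \<open>U\<close> with closure
  in \<open>W\<close>: the component of \<open>x\<close> in the rest bumps into the closure of \<open>U\<close>.
\<close>
lemma composant_of_dense: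
  assumes I: "continuum I" and x: "x \<in> topspace I"
  shows "I closure_of composant_of I x = topspace I"
proof -
  have "composant_of I x \<inter> W \<noteq> {}" if W: "openin I W" "W \<noteq> {}" for W
  proof (cases "x \<in> W")
    case True
    then show ?thesis using composant_of_refl[OF I x] by blast
  next
    case False
    obtain z where z: "z \<in> W" using W by blast
    have "regular_space I"
      using I by (simp add: continuum_def metrizable_imp_regular_space)
    moreover have "closedin I (topspace I - W)" "z \<in> topspace I - (topspace I - W)"
      using W z openin_subset by blast+
    ultimately obtain U where U: "openin I U" "z \<in> U" "disjnt (topspace I - W) (I closure_of U)"
      unfolding regular_space by blast
    then have "I closure_of U \<subseteq> W"
      using closure_of_subset_topspace[of I U] by (auto simp: disjnt_iff)
    have "x \<in> topspace I - U"
      using x U False \<open>I closure_of U \<subseteq> W\<close>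
      by (metis DiffI closure_of_subset openin_subset subset_iff)
    then obtain y where "y \<in> I closure_of U" "(x, y) \<in> joined_off I U"
      using joined_off_boundary_bumping[OF I U(1)] U(2) by blast
    then show ?thesis
      using U \<open>I closure_of U \<subseteq> W\<close> composant_of_eq_joined_off[OF I x] by blast
  qed
  then show ?thesis
    by (simp add: dense_intersects_open)
qed

lemma composant_of_subset: "composant_of I x \<subseteq> topspace I"
  by (auto simp: composant_of_def subcontinuum_def)

lemma composant_subset_nonempty:
  assumes "continuum I" "composant I P"
  shows "P \<subseteq> topspace I" "P \<noteq> {}"
proof -
  obtain x where x: "x \<in> topspace I" "P = composant_of I x"
    using assms(2) unfolding composant_def by blast
  then show "P \<subseteq> topspace I" "P \<noteq> {}"
    using composant_of_subset composant_of_refl[OF assms(1)] by fast+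
qed

text \<open>
  The balls of radius \<open>1 / (n + 1)\<close> about the points of a finite net of that mesh, for all \<open>n\<close>.
\<close>
lemma compact_metrizable_countable_pi_base:
  assumes "compact_space X" "metrizable_space X"
  obtains \<B> where "countable \<B>" "\<And>B. B \<in> \<B> \<Longrightarrow> openin X B \<and> B \<noteq> {}"
    "\<And>U. \<lbrakk>openin X U; U \<noteq> {}\<rbrakk> \<Longrightarrow> \<exists>B\<in>\<B>. B \<subseteq> U"
proof -
  obtain M d where "Metric_space M d" and X: "X = Metric_space.mtopology M d"
    using assms(2) unfolding metrizable_space_def by blast
  then interpret Metric_space M d by blast
  have "\<exists>K. finite K \<and> K \<subseteq> M \<and> M \<subseteq> (\<Union>x\<in>K. mball x (inverse (Suc n)))" for n
    using assms(1) unfolding X compact_space_eq_mcomplete_mtotally_bounded mtotally_bounded_def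
    by (metis inverse_positive_iff_positive of_nat_0_less_iff zero_less_Suc)
  then obtain K where K: "\<And>n. finite (K n)" "\<And>n. K n \<subseteq> M"
     "\<And>n. M \<subseteq> (\<Union>x\<in>K n. mball x (inverse (Suc n)))"
    by metis
  define \<B> where "\<B> = (\<Union>n. (\<lambda>x. mball x (inverse (Suc n))) ` K n)"
  show thesis
  proof
    show "countable \<B>" using K(1) by (auto simp: \<B>_def countable_finite)
    show "openin X B \<and> B \<noteq> {}" if "B \<in> \<B>" for B
      using that K(2) unfolding \<B>_def X by (force simp: mball_eq_empty)
    fix U assume U: "openin X U" "U \<noteq> {}"
    then obtain u r where u: "u \<in> U" "u \<in> M" "r > 0" "mball u r \<subseteq> U"
      unfolding X openin_mtopology by blast
    obtain n where n: "inverse (Suc n) < r / 2"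
      using u(3) reals_Archimedean half_gt_zero by blast
    obtain x where x: "x \<in> K n" "u \<in> mball x (inverse (Suc n))"
      using K(3) u(2) by blast
    have "mball x (inverse (Suc n)) \<subseteq> mball u r"
    proof
      fix y assume "y \<in> mball x (inverse (Suc n))"
      then show "y \<in> mball u r"
        using x(2) n triangle[of u x y] by (auto simp: commute)
    qed
    then show "\<exists>B\<in>\<B>. B \<subseteq> U"
      using u(4) x(1) unfolding \<B>_def by blast
  qed
qed

text \<open>
  The complement of a proper subcontinuum contains a member of the countable \<open>\<pi>\<close>-base, so the
  relations indexed by that base suffice.
\<close>
lemma composant_of_countable_union:
  assumes I: "continuum I"
  obtains U :: "nat \<Rightarrow> 'a set" where "\<And>n. openin I (U n)" "\<And>n. U n \<noteq> {}"
    "\<And>x. x \<in> topspace I \<Longrightarrow> composant_of I x = {y. \<exists>n. (x, y) \<in> joined_off I (U n)}"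
proof -
  obtain \<B> where \<B>: "countable \<B>" "\<And>B. B \<in> \<B> \<Longrightarrow> openin I B \<and> B \<noteq> {}"
    "\<And>U. \<lbrakk>openin I U; U \<noteq> {}\<rbrakk> \<Longrightarrow> \<exists>B\<in>\<B>. B \<subseteq> U"
    using compact_metrizable_countable_pi_base I unfolding continuum_def by metis
  have "\<B> \<noteq> {}"
    using \<B>(3)[OF openin_topspace] I unfolding continuum_def by blast
  define U where "U = from_nat_into \<B>"
  have ran: "range U = \<B>"
    using \<B>(1) \<open>\<B> \<noteq> {}\<close> by (simp add: U_def)
  then have U: "openin I (U n)" "U n \<noteq> {}" for n using \<B>(2) by blast+
  show thesis
  proof (rule that[of U])
    fix x assume x: "x \<in> topspace I"
    show "composant_of I x = {y. \<exists>n. (x, y) \<in> joined_off I (U n)}"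
    proof (intro set_eqI iffI)
      fix y assume "y \<in> composant_of I x"
      then obtain W where W: "openin I W" "W \<noteq> {}" "(x, y) \<in> joined_off I W"
        using composant_of_eq_joined_off[OF I x] by blast
      then obtain n where "U n \<subseteq> W" using \<B>(3) ran by (metis imageE)
      then show "y \<in> {y. \<exists>n. (x, y) \<in> joined_off I (U n)}"
        using joined_off_mono[OF I W(1) U(1)] W(3) by blast
    qed (use U composant_of_eq_joined_off[OF I x] in blast)
  qed (use U in auto)
qed

section \<open>Composants of an indecomposable continuum\<close>

text \<open>
  If two disjoint closed sets split \<open>C \<union> A\<close>, then the one that misses \<open>C\<close> lies in \<open>A\<close>,
  so it is open as well and contradicts the connectedness of the whole space.
\<close>
lemma connectedin_Un_clopen_in_complement:
  assumes X: "connected_space X" and C: "closedin X C" "connectedin X C"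
    and AB: "openin X A" "openin X B" "A \<union> B = topspace X - C" "A \<inter> B = {}"
  shows "connectedin X (C \<union> A)"
proof (rule ccontr)
  have "C \<union> A = topspace X - B"
    using AB closedin_subset[OF C(1)] by blast
  then have clo: "closedin X (C \<union> A)"
    using AB by (metis closedin_diff closedin_topspace)
  assume "\<not> connectedin X (C \<union> A)"
  then obtain H K where HK: "closedin X H" "closedin X K" "H \<union> K = C \<union> A" "H \<inter> K = {}"
      "H \<noteq> {}" "K \<noteq> {}"
    using clo closedin_subset[OF clo]
    by (auto simp: connectedin_def connected_space_closedin_eq closedin_closed_subtopology Int_absorb1)
  have *: False
    if "closedin X H" "closedin X K" "H \<union> K = C \<union> A" "H \<inter> K = {}" "H \<noteq> {}" "K \<noteq> {}" "C \<subseteq> H" for H K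
  proof -
    have "K = A - H" using that by blast
    then have "openin X K" using AB(1) that(1) by (simp add: openin_diff)
    then have "K = topspace X"
      using X that(2,6) connected_space_clopen_in by blast
    then show False
      using that closedin_subset[of X H] by blast
  qed
  have "C \<subseteq> H \<or> C \<subseteq> K"
    using connectedin_subset_separated_union[OF C(2), of H K] HK
    by (auto simp: separatedin_closed_sets disjnt_def)
  then show False
  proof
    assume "C \<subseteq> H"
    with *[OF HK] show False .
  next
    assume "C \<subseteq> K"
    moreover have "K \<union> H = C \<union> A" "K \<inter> H = {}"
      using HK by blast+
    ultimately show False
      using *[OF HK(2,1) _ _ HK(6,5)] by blast
  qed
qed

text \<open>
  If the complement of \<open>C\<close> is connected, then \<open>I\<close> is the union of \<open>C\<close> and the closure of
  that complement; otherwise a separation of the complement splits \<open>I\<close> into two proper closed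
  connected sets that overlap in \<open>C\<close>.  Indecomposability leaves only the first case, with a
  dense complement.
\<close>
lemma indecomposable_nowhere_dense:
  assumes I: "indecomposable I" and C: "closedin I C" "connectedin I C" "C \<noteq> topspace I"
  shows "I interior_of C = {}"
proof -
  have conn: "connected_space I"
    and dec: "\<And>A B. \<lbrakk>closedin I A; connectedin I A; A \<noteq> topspace I; closedin I B; connectedin I B;
        A \<union> B = topspace I\<rbrakk> \<Longrightarrow> B = topspace I"
    using I unfolding indecomposable_def decomposable_def by blast+
  define V where "V = topspace I - C"
  have V: "openin I V" "V \<subseteq> topspace I" using C by (auto simp: V_def)
  have "connectedin I V"
  proof (rule ccontr)
    assume "\<not> connectedin I V"
    then obtain A B where AB: "openin I A" "openin I B" "A \<union> B = V" "A \<inter> B = {}" "A \<noteq> {}" "B \<noteq> {}"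
      using V by (auto simp: connectedin_def connected_space_eq openin_open_subtopology Int_absorb1)
    have "C \<union> A = topspace I - B" "C \<union> B = topspace I - A"
      using AB closedin_subset[OF C(1)] by (auto simp: V_def)
    moreover from this have "closedin I (C \<union> A)" "closedin I (C \<union> B)"
      using AB by (metis closedin_diff closedin_topspace)+
    moreover have "connectedin I (C \<union> A)" "connectedin I (C \<union> B)"
      using connectedin_Un_clopen_in_complement[OF conn C(1,2), of A B]
        connectedin_Un_clopen_in_complement[OF conn C(1,2), of B A] AB
      by (auto simp: V_def Un_commute Int_commute)
    moreover have "A \<subseteq> topspace I" "B \<subseteq> topspace I"
      using AB openin_subset by blast+
    ultimately show False
      using AB dec[of "C \<union> A" "C \<union> B"] by blast
  qed
  then have "connectedin I (I closure_of V)"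
    by (rule connectedin_closure_of)
  moreover have "C \<union> I closure_of V = topspace I"
    using closure_of_subset[OF V(2)] closure_of_subset_topspace[of I V] closedin_subset[OF C(1)]
    by (auto simp: V_def)
  ultimately have "I closure_of V = topspace I"
    using dec[OF C] by simp
  then show ?thesis
    by (simp add: V_def interior_of_closure_of)
qed

lemma joined_off_section_nowhere_dense:
  assumes I: "continuum I" "indecomposable I" and U: "openin I U" "U \<noteq> {}"
  shows "I interior_of {y. (x, y) \<in> joined_off I U} = {}"
proof (rule indecomposable_nowhere_dense[OF I(2)])
  show "{y. (x, y) \<in> joined_off I U} \<noteq> topspace I"
    using joined_off_section(3)[OF I(1) U(1), of x] U openin_subset by blast
qed (use joined_off_section[OF I(1) U(1)] in auto)

text \<open>
  Two proper subcontinua with a common point have a proper union, by indecomposability; so belonging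
  to a common proper subcontinuum is transitive.
\<close>
lemma composant_of_eq:
  assumes I: "continuum I" "indecomposable I" and y: "y \<in> composant_of I x"
  shows "composant_of I y = composant_of I x"
proof -
  have step: "composant_of I y \<subseteq> composant_of I x" if y: "y \<in> composant_of I x" for x y
  proof
    fix z assume "z \<in> composant_of I y"
    then obtain D where D: "subcontinuum I D" "D \<noteq> topspace I" "y \<in> D" "z \<in> D"
      by (auto simp: composant_of_def)
    obtain C where C: "subcontinuum I C" "C \<noteq> topspace I" "x \<in> C" "y \<in> C"
      using y by (auto simp: composant_of_def)
    have CD: "closedin I C" "connectedin I C" "closedin I D" "connectedin I D"
      using C D subcontinuum_iff[OF I(1)] by blast+
    have "C \<union> D \<noteq> topspace I"
      using I(2) C(2) D(2) CD unfolding indecomposable_def decomposable_def by blast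
    moreover have "connectedin I (C \<union> D)"
      using CD C(4) D(3) by (intro connectedin_Un) auto
    moreover have "closedin I (C \<union> D)" using CD by blast
    moreover have "\<exists>x\<in>C \<union> D. \<exists>y\<in>C \<union> D. x \<noteq> y"
      using C(1) subcontinuum_iff[OF I(1)] by blast
    ultimately have "subcontinuum I (C \<union> D)" "C \<union> D \<noteq> topspace I"
      unfolding subcontinuum_iff[OF I(1)] by blast+
    then show "z \<in> composant_of I x"
      using C(3) D(4) by (auto simp: composant_of_def)
  qed
  have "x \<in> composant_of I y"
    using y by (auto simp: composant_of_def)
  then show ?thesis
    using step y by blast
qed

lemma composants_disjoint:
  assumes I: "continuum I" "indecomposable I" and y: "y \<in> topspace I" "y \<notin> composant_of I x"
  shows "composant_of I x \<inter> composant_of I y = {}"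
proof (rule ccontr)
  assume "composant_of I x \<inter> composant_of I y \<noteq> {}"
  then obtain z where "z \<in> composant_of I x" "z \<in> composant_of I y" by blast
  then have "composant_of I x = composant_of I y" using composant_of_eq[OF I] by metis
  then show False using y composant_of_refl[OF I(1)] by blast
qed

lemma semicontinuum_composant_of:
  assumes I: "continuum I" "indecomposable I"
  shows "semicontinuum (subtopology I (composant_of I x))"
  unfolding semicontinuum_def
proof (intro ballI)
  fix u v assume "u \<in> topspace (subtopology I (composant_of I x))"
    "v \<in> topspace (subtopology I (composant_of I x))"
  then have uv: "u \<in> composant_of I x" "v \<in> composant_of I x" by auto
  then have eq: "composant_of I u = composant_of I x"
    using composant_of_eq[OF I] by blast
  with uv obtain C where C: "subcontinuum I C" "C \<noteq> topspace I" "u \<in> C" "v \<in> C"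
    by (auto simp: composant_of_def[of I u])
  then have "C \<subseteq> composant_of I u"
    unfolding composant_of_def by (intro Union_upper) simp
  then have sub: "C \<subseteq> composant_of I x"
    by (simp only: eq)
  have "subcontinuum (subtopology I (composant_of I x)) C"
    using C(1) sub unfolding subcontinuum_def by (simp add: subtopology_subtopology Int_absorb1)
  then show "\<exists>C. subcontinuum (subtopology I (composant_of I x)) C \<and> u \<in> C \<and> v \<in> C"
    using C by blast
qed

section \<open>A Cantor scheme that avoids countably many closed relations\<close>

context Metric_space begin

lemma eventually_mcball_subset_open:
  assumes "openin mtopology V" "a \<in> V"
  shows "\<forall>\<^sub>F r in at_right (0::real). mcball a r \<subseteq> V"
proof -
  obtain r0 where "r0 > 0" "mcball a r0 \<subseteq> V"
    using assms openin_mtopology_mcball by blast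
  then show ?thesis
    unfolding eventually_at_right_field
    by (metis less_imp_le mcball_subset_concentric subset_trans)
qed

lemma eventually_mcball_Times_disjoint_closed:
  assumes E: "closedin (prod_topology mtopology mtopology) E" and ab: "(a, b) \<notin> E" "a \<in> M" "b \<in> M"
  shows "\<forall>\<^sub>F r in at_right (0::real). mcball a r \<times> mcball b r \<inter> E = {}"
proof -
  have "openin (prod_topology mtopology mtopology) (M \<times> M - E)"
    using E by (metis openin_diff openin_topspace topspace_mtopology topspace_prod_topology)
  moreover have "(a, b) \<in> M \<times> M - E" using ab by simp
  ultimately obtain V W where VW: "openin mtopology V" "openin mtopology W" "a \<in> V" "b \<in> W"
    "V \<times> W \<subseteq> M \<times> M - E"
    unfolding openin_prod_topology_alt by meson
  show ?thesis
    using eventually_mcball_subset_open[OF VW(1,3)] eventually_mcball_subset_open[OF VW(2,4)]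
    by eventually_elim (use VW(5) in blast)
qed

text \<open>
  A variant of the independence theorems of Mycielski and Kuratowski.  Balls attached to the nodes of
  the binary tree shrink along branches, and the balls at level \<open>n\<close> avoid \<open>F n\<close> and, in pairs,
  \<open>E k\<close> for all \<open>k \<le> n\<close>.  Two different branches are at different nodes from some level on,
  so points on them are unrelated by every \<open>E k\<close>.  Since the centre at node \<open>s\<close> is taken from
  its own dense set \<open>c s\<close>, all conditions of a level hold for the centres already, and a small
  common radius makes them hold for the balls.  Compactness provides a point on every branch.
\<close>
lemma Cantor_scheme_avoiding_relations:
  fixes c :: "bool list \<Rightarrow> 'a set"
  assumes comp: "compact_space mtopology" and "M \<noteq> {}"
    and E: "\<And>n::nat. closedin (prod_topology mtopology mtopology) (E n)"
    and F: "\<And>n::nat. closedin mtopology (F n)"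
    and dense: "\<And>s. c s \<subseteq> M" "\<And>s. mtopology closure_of (c s) = M"
    and cF: "\<And>s n. c s \<inter> F n = {}"
    and cE: "\<And>s t x y n. \<lbrakk>s \<noteq> t; x \<in> c s; y \<in> c t\<rbrakk> \<Longrightarrow> (x, y) \<notin> E n"
  obtains f :: "nat set \<Rightarrow> 'a" where "\<And>A. f A \<in> M" "\<And>A n. f A \<notin> F n"
    "\<And>A B n. A \<noteq> B \<Longrightarrow> (f A, f B) \<notin> E n"
proof -
  define good where "good n pr \<longleftrightarrow> (case pr of (p, r) \<Rightarrow> r > (0::real) \<and>
      (\<forall>s. length s = n \<longrightarrow> p s \<in> c s \<and> mcball (p s) r \<inter> F n = {}) \<and>
      (\<forall>s t. length s = n \<and> length t = n \<and> s \<noteq> t \<longrightarrow>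
         (\<forall>k\<le>n. mcball (p s) r \<times> mcball (p t) r \<inter> E k = {})))" for n pr
  define refines where "refines n pr pr' \<longleftrightarrow> (case (pr, pr') of ((p, r), (p', r')) \<Rightarrow>
      \<forall>s b. length s = n \<longrightarrow> mcball (p' (s @ [b])) r' \<subseteq> mcball (p s) (r::real))"
    for n and pr pr' :: "(bool list \<Rightarrow> 'a) \<times> real"
  have fin: "finite {s :: bool list. length s = n}" for n
    using finite_lists_length_eq[of "UNIV :: bool set" n] by simp
  have radius: "\<exists>r. good n (p, r) \<and> (\<forall>s. length s = n \<longrightarrow> mcball (p s) r \<subseteq> V s)"
    if p: "\<And>s. length s = n \<Longrightarrow> p s \<in> c s"
      and V: "\<And>s. length s = n \<Longrightarrow> openin mtopology (V s) \<and> p s \<in> V s" for n p V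
  proof -
    let ?L = "{s :: bool list. length s = n}"
    have 1: "\<forall>\<^sub>F r in at_right (0::real). \<forall>s\<in>?L. mcball (p s) r \<subseteq> V s"
      using V eventually_mcball_subset_open by (intro eventually_ball_finite fin) blast
    have "openin mtopology (M - F n)"
      using F[of n] by (metis openin_diff openin_topspace topspace_mtopology)
    moreover have "p s \<in> M - F n" if "length s = n" for s
      using p[OF that] dense(1) cF by blast
    ultimately have 2: "\<forall>\<^sub>F r in at_right (0::real). \<forall>s\<in>?L. mcball (p s) r \<subseteq> M - F n"
      using eventually_mcball_subset_open by (intro eventually_ball_finite fin) blast
    have 3: "\<forall>\<^sub>F r in at_right (0::real). \<forall>s\<in>?L. \<forall>t\<in>?L - {s}. \<forall>k\<in>{..n}.
        mcball (p s) r \<times> mcball (p t) r \<inter> E k = {}"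
    proof (intro eventually_ball_finite fin finite_Diff finite_atMost ballI)
      fix s t k assume "s \<in> ?L" "t \<in> ?L - {s}"
      then have "p s \<in> c s" "p t \<in> c t" "s \<noteq> t" using p by auto
      then show "\<forall>\<^sub>F r in at_right (0::real). mcball (p s) r \<times> mcball (p t) r \<inter> E k = {}"
        using cE[of s t "p s" "p t" k] dense(1) E by (intro eventually_mcball_Times_disjoint_closed) auto
    qed
    have "\<forall>\<^sub>F r in at_right (0::real). r > 0 \<and> (\<forall>s\<in>?L. mcball (p s) r \<subseteq> V s) \<and>
        (\<forall>s\<in>?L. mcball (p s) r \<subseteq> M - F n) \<and>
        (\<forall>s\<in>?L. \<forall>t\<in>?L - {s}. \<forall>k\<in>{..n}. mcball (p s) r \<times> mcball (p t) r \<inter> E k = {})"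
      using 1 2 3 eventually_at_right_less[of 0] by (intro eventually_conj)
    from eventually_happens'[OF trivial_limit_at_right_real this]
    obtain r where r: "r > 0" "\<forall>s\<in>?L. mcball (p s) r \<subseteq> V s" "\<forall>s\<in>?L. mcball (p s) r \<subseteq> M - F n"
        "\<forall>s\<in>?L. \<forall>t\<in>?L - {s}. \<forall>k\<in>{..n}. mcball (p s) r \<times> mcball (p t) r \<inter> E k = {}"
      by (elim exE conjE) (rule that)
    have "good n (p, r)"
      unfolding good_def prod.case using r(1,3,4) p by blast
    then show ?thesis using r(2) by blast
  qed
  have "\<exists>\<sigma>. \<forall>n. good n (\<sigma> n) \<and> refines n (\<sigma> n) (\<sigma> (Suc n))"
  proof (rule dependent_nat_choice)
    have "c [] \<noteq> {}"
      using dense(2)[of "[]"] \<open>M \<noteq> {}\<close> by auto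
    then obtain x where "x \<in> c []" by blast
    then show "\<exists>pr. good 0 pr"
      using radius[of 0 "\<lambda>_. x" "\<lambda>_. M"] dense(1)
      by (metis length_0_conv openin_topspace subsetD topspace_mtopology)
  next
    fix pr n assume g: "good n pr"
    obtain p r where pr: "pr = (p, r)" by force
    have r: "r > 0" and p: "\<And>s. length s = n \<Longrightarrow> p s \<in> M"
      using g dense(1) unfolding good_def pr by auto
    have "\<exists>x. x \<in> c (s @ [b]) \<and> x \<in> mball (p s) r" if "length s = n" for s b
    proof -
      have "mball (p s) r \<noteq> {}" using r p[OF that] by auto
      then have "c (s @ [b]) \<inter> mball (p s) r \<noteq> {}"
        using dense(2)[of "s @ [b]"] dense_intersects_open[of mtopology "c (s @ [b])"]
        by (simp add: openin_mball)
      then show ?thesis by blast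
    qed
    then obtain q where q: "\<And>s b. length s = n \<Longrightarrow> q s b \<in> c (s @ [b]) \<and> q s b \<in> mball (p s) r"
      by metis
    (* Nodes of level n + 1 have the form s @ [b], so butlast gives the parent node. *)
    define p' where "p' s = q (butlast s) (last s)" for s
    have p'_snoc: "p' (s @ [b]) = q s b" for s b by (simp add: p'_def)
    have snoc: "\<exists>u b. s = u @ [b] \<and> length u = n" if "length s = Suc n" for s :: "bool list"
      using that by (metis length_Suc_conv_rev)
    obtain r' where r': "good (Suc n) (p', r')"
      "\<And>s. length s = Suc n \<Longrightarrow> mcball (p' s) r' \<subseteq> mball (p (butlast s)) r"
    proof -
      have "\<exists>r'. good (Suc n) (p', r') \<and>
          (\<forall>s. length s = Suc n \<longrightarrow> mcball (p' s) r' \<subseteq> mball (p (butlast s)) r)"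
      proof (rule radius)
        fix s :: "bool list" assume "length s = Suc n"
        then obtain u b where s: "s = u @ [b]" "length u = n" using snoc by blast
        show "p' s \<in> c s" using q[OF s(2)] by (simp add: s(1) p'_snoc)
        show "openin mtopology (mball (p (butlast s)) r) \<and> p' s \<in> mball (p (butlast s)) r"
          using q[OF s(2), of b] by (simp only: s(1) p'_snoc butlast_snoc openin_mball)
      qed
      then show thesis using that by blast
    qed
    have "refines n pr (p', r')"
      unfolding refines_def pr prod.case
    proof (intro allI impI)
      fix s :: "bool list" and b assume "length s = n"
      then show "mcball (p' (s @ [b])) r' \<subseteq> mcball (p s) r"
        using r'(2)[of "s @ [b]"] mball_subset_mcball[of "p s" r] by simp
    qed
    with r'(1) show "\<exists>pr'. good (Suc n) pr' \<and> refines n pr pr'" by blast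
  qed
  then obtain \<sigma> where \<sigma>: "\<And>n. good n (\<sigma> n)" "\<And>n. refines n (\<sigma> n) (\<sigma> (Suc n))" by blast
  define p r where "p n = fst (\<sigma> n)" and "r n = snd (\<sigma> n)" for n
  have r0: "r n > 0" for n
    using \<sigma>(1)[of n] by (auto simp: good_def r_def split: prod.splits)
  have pc: "p n s \<in> c s" and pF: "mcball (p n s) (r n) \<inter> F n = {}" if "length s = n" for n s
    using \<sigma>(1)[of n] that by (auto simp: good_def r_def p_def split: prod.splits)
  have pE: "mcball (p n s) (r n) \<times> mcball (p n t) (r n) \<inter> E k = {}"
    if "length s = n" "length t = n" "s \<noteq> t" "k \<le> n" for n s t k
    using \<sigma>(1)[of n] that unfolding good_def r_def p_def by (simp add: case_prod_unfold)
  have nest: "mcball (p (Suc n) (s @ [b])) (r (Suc n)) \<subseteq> mcball (p n s) (r n)" if "length s = n" for n s b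
    using \<sigma>(2)[of n] that by (simp add: refines_def r_def p_def case_prod_unfold)
  (* w A n is the node of level n on the branch given by the characteristic function of A. *)
  define w where "w A n = map (\<lambda>i. i \<in> A) [0..<n]" for A :: "nat set" and n
  have w: "length (w A n) = n" "w A (Suc n) = w A n @ [n \<in> A]" for A n
    by (simp_all add: w_def)
  define C where "C A n = mcball (p n (w A n)) (r n)" for A n
  have "(\<Inter>n. C A n) \<noteq> {}" for A
  proof (rule compact_space_imp_nest[OF comp])
    show "closedin mtopology (C A n)" for n by (simp add: C_def)
    show "C A n \<noteq> {}" for n
      using pc[OF w(1)] dense(1) r0[of n] unfolding C_def
      by (metis centre_in_mcball_iff empty_iff less_imp_le subsetD)
    show "decseq (C A)"
      by (rule decseq_SucI) (simp add: C_def w nest)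
  qed
  then have "\<forall>A. \<exists>x. \<forall>n. x \<in> C A n"
    by (simp flip: ex_in_conv)
  then obtain f where f: "\<And>A n. f A \<in> C A n"
    by metis
  show thesis
  proof
    show "f A \<in> M" for A
      using f[of A 0] by (simp add: C_def)
    show "f A \<notin> F n" for A n
      using f[of A n] pF[OF w(1)[of A n]] unfolding C_def by blast
    fix A B :: "nat set" and k assume "A \<noteq> B"
    then obtain i where i: "(i \<in> A) \<noteq> (i \<in> B)" by blast
    (* By level Suc i the branches have split, and from level k on the pairs of balls avoid E k. *)
    define n where "n = max k (Suc i)"
    have "w A n ! i \<noteq> w B n ! i"
      using i by (simp add: w_def n_def nth_append less_max_iff_disj del: upt_Suc)
    then have "w A n \<noteq> w B n" by auto
    moreover have "k \<le> n" by (simp add: n_def)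
    ultimately show "(f A, f B) \<notin> E k"
      using pE[OF w(1) w(1)] f[of A n] f[of B n] unfolding C_def by blast
  qed
qed

end

section \<open>Continuum many composants inside a G-delta set\<close>

text \<open>
  The union of the composants that meet the complement of \<open>G\<close> is \<open>F\<^sub>\<sigma>\<close>, since the
  complement and the relation of lying in a common composant are.  Each closed piece misses the dense
  set \<open>P\<close> and so is nowhere dense.
\<close>
lemma composants_leaving_gdelta_meager:
  assumes I: "continuum I" "indecomposable I" and P: "composant I P"
    and G: "gdelta_in I G" "P \<subseteq> G"
  obtains F :: "nat \<Rightarrow> 'a set" where "\<And>j. closedin I (F j)" "\<And>j. I interior_of (F j) = {}"
    "\<And>y. y \<in> topspace I \<Longrightarrow> (\<forall>j. y \<notin> F j) \<longleftrightarrow> composant_of I y \<subseteq> G"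
proof -
  have comp: "compact_space I"
    using I(1) unfolding continuum_def by auto
  obtain U :: "nat \<Rightarrow> 'a set" where U: "\<And>n. openin I (U n)" "\<And>n. U n \<noteq> {}"
    and comp_iff: "\<And>x. x \<in> topspace I \<Longrightarrow> composant_of I x = {y. \<exists>n. (x, y) \<in> joined_off I (U n)}"
    using composant_of_countable_union[OF I(1)] by metis
  define R where "R n = joined_off I (U n)" for n
  have R: "closedin (prod_topology I I) (R n)" for n
    unfolding R_def by (rule closedin_joined_off[OF U(1)])
  have compR: "y \<in> composant_of I x \<longleftrightarrow> (\<exists>n. (x, y) \<in> R n)" if "x \<in> topspace I" for x y
    using comp_iff[OF that] by (simp add: R_def)
  have sym: "x \<in> composant_of I y \<longleftrightarrow> y \<in> composant_of I x" for x y
    by (auto simp: composant_of_def)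
  have "fsigma_in I (topspace I - G)"
    using G(1) by (simp add: gdelta_in_fsigma_in)
  then obtain C :: "nat \<Rightarrow> 'a set" where "\<forall>m. closedin I (C m)" and C_Un: "\<Union>(range C) = topspace I - G"
    unfolding fsigma_in_ascending by (elim exE conjE) (rule that)
  then have C: "\<And>m. closedin I (C m)" "\<Union>(range C) = topspace I - G" by simp_all
  (* K n m consists of the points joined off U n to a point of C m: a projection along the compact
     space I. *)
  define K where "K n m = snd ` ((C m \<times> topspace I) \<inter> R n)" for n m
  have K_closed: "closedin I (K n m)" for n m
  proof -
    have "closedin (prod_topology I I) (C m \<times> topspace I)"
      using C(1) by (simp add: closedin_prod_Times_iff)
    then have "closedin (prod_topology I I) ((C m \<times> topspace I) \<inter> R n)"
      using R by (rule closedin_Int)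
    then show ?thesis
      using closed_map_snd[OF comp, of I] unfolding K_def closed_map_def by blast
  qed
  have K_iff: "(\<forall>n m. y \<notin> K n m) \<longleftrightarrow> composant_of I y \<subseteq> G" if y: "y \<in> topspace I" for y
  proof -
    have "(\<exists>n m. y \<in> K n m) \<longleftrightarrow> (\<exists>x m n. x \<in> C m \<and> (x, y) \<in> R n)"
      unfolding K_def using y by force
    also have "\<dots> \<longleftrightarrow> (\<exists>x \<in> topspace I - G. y \<in> composant_of I x)"
      using compR C closedin_subset[OF C(1)] unfolding C(2)[symmetric] by blast
    also have "\<dots> \<longleftrightarrow> \<not> composant_of I y \<subseteq> G"
      using sym composant_of_subset[of I y] by blast
    finally show ?thesis by blast
  qed
  obtain p where p: "p \<in> topspace I" "P = composant_of I p"
    using P unfolding composant_def by blast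
  have K_nowhere: "I interior_of (K n m) = {}" for n m
  proof -
    have "P \<inter> K n m = {}"
    proof -
      have "y \<notin> K n m" if "y \<in> P" for y
        using K_iff[of y] composant_of_eq[OF I] that G(2) composant_of_subset[of I p] p(2) by blast
      then show ?thesis by blast
    qed
    then have "P \<inter> I interior_of (K n m) = {}"
      using interior_of_subset by fastforce
    moreover have "I closure_of P = topspace I"
      using composant_of_dense[OF I(1)] p by blast
    ultimately show ?thesis
      unfolding dense_intersects_open by (metis openin_interior_of)
  qed
  define F where "F j = (case prod_decode j of (n, m) \<Rightarrow> K n m)" for j
  have F: "closedin I (F j)" "I interior_of (F j) = {}" for j
    by (auto simp: F_def K_closed K_nowhere split: prod.splits)
  have F_iff: "(\<forall>j. y \<notin> F j) \<longleftrightarrow> composant_of I y \<subseteq> G" if y: "y \<in> topspace I" for y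
  proof -
    have "(\<forall>j. y \<notin> F j) \<longleftrightarrow> (\<forall>n m. y \<notin> K n m)"
      unfolding F_def by (metis case_prod_conv prod_encode_inverse surj_pair)
    then show ?thesis using K_iff[OF y] by simp
  qed
  show thesis
    by (rule that[OF F F_iff])
qed

text \<open>
  Otherwise finitely many composants, which are meager, and the sets \<open>F j\<close> would cover \<open>I\<close>,
  against Baire's theorem.
\<close>
lemma infinite_composants_inside_comeager:
  assumes I: "continuum I" "indecomposable I"
    and F: "\<And>j::nat. closedin I (F j)" "\<And>j. I interior_of (F j) = {}"
    and F_iff: "\<And>y. y \<in> topspace I \<Longrightarrow> (\<forall>j. y \<notin> F j) \<longleftrightarrow> composant_of I y \<subseteq> G"
  shows "infinite {Q. composant I Q \<and> Q \<subseteq> G}"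
proof
  define \<Q> where "\<Q> = {Q. composant I Q \<and> Q \<subseteq> G}"
  assume "finite {Q. composant I Q \<and> Q \<subseteq> G}"
  then have fin: "finite \<Q>" by (simp add: \<Q>_def)
  have comp: "compact_space I" and met: "metrizable_space I" and ne: "topspace I \<noteq> {}"
    using I(1) unfolding continuum_def by auto
  obtain U :: "nat \<Rightarrow> 'a set" where U: "\<And>n. openin I (U n)" "\<And>n. U n \<noteq> {}"
    and comp_iff: "\<And>x. x \<in> topspace I \<Longrightarrow> composant_of I x = {y. \<exists>n. (x, y) \<in> joined_off I (U n)}"
    using composant_of_countable_union[OF I(1)] by metis
  define R where "R n = joined_off I (U n)" for n
  have compR: "y \<in> composant_of I x \<longleftrightarrow> (\<exists>n. (x, y) \<in> R n)" if "x \<in> topspace I" for x y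
    using comp_iff[OF that] by (simp add: R_def)
  have "\<forall>Q\<in>\<Q>. \<exists>x. x \<in> topspace I \<and> Q = composant_of I x"
    unfolding \<Q>_def composant_def by blast
  then obtain q where q: "\<And>Q. Q \<in> \<Q> \<Longrightarrow> q Q \<in> topspace I \<and> Q = composant_of I (q Q)"
    by metis
  define \<G> where "\<G> = range F \<union> (\<Union>n. (\<lambda>Q. {y. (q Q, y) \<in> R n}) ` \<Q>)"
  have "I interior_of \<Union>\<G> = {}"
  proof (rule Baire_category_alt)
    show "completely_metrizable_space I \<or> locally_compact_space I \<and> regular_space I"
      using comp met by (simp add: compact_imp_locally_compact_space metrizable_imp_regular_space)
    show "countable \<G>" using fin by (auto simp: \<G>_def countable_finite)
    show "closedin I T \<and> I interior_of T = {}" if "T \<in> \<G>" for T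
      using that F joined_off_section(1)[OF I(1) U(1)] joined_off_section_nowhere_dense[OF I U]
      by (auto simp: \<G>_def R_def)
  qed
  moreover have "topspace I \<subseteq> \<Union>\<G>"
  proof
    fix y assume y: "y \<in> topspace I"
    show "y \<in> \<Union>\<G>"
    proof (cases "composant_of I y \<subseteq> G")
      case True
      then have Q: "composant_of I y \<in> \<Q>" using y by (auto simp: \<Q>_def composant_def)
      then have "y \<in> composant_of I (q (composant_of I y))"
        using q composant_of_refl[OF I(1) y] by metis
      then obtain n where "(q (composant_of I y), y) \<in> R n"
        using compR q[OF Q] by blast
      then show ?thesis
        using Q by (auto simp: \<G>_def)
    next
      case False
      then show ?thesis using F_iff[OF y] by (auto simp: \<G>_def)
    qed
  qed
  ultimately have "I interior_of topspace I = {}"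
    by (metis interior_of_mono subset_empty)
  then show False using ne by simp
qed

lemma composants_inside_gdelta:
  assumes I: "continuum I" "indecomposable I" and P: "composant I P"
    and G: "gdelta_in I G" "P \<subseteq> G"
  obtains f :: "nat set \<Rightarrow> 'a" where "\<And>A. f A \<in> topspace I" "\<And>A. composant_of I (f A) \<subseteq> G"
    "\<And>A B. A \<noteq> B \<Longrightarrow> composant_of I (f A) \<inter> composant_of I (f B) = {}"
proof -
  have comp: "compact_space I" and met: "metrizable_space I" and ne: "topspace I \<noteq> {}"
    using I(1) unfolding continuum_def by auto
  obtain M d where "Metric_space M d" and I_eq: "I = Metric_space.mtopology M d"
    using met unfolding metrizable_space_def by blast
  then interpret Metric_space M d by blast
  have M: "M = topspace I" by (simp add: I_eq)
  obtain U :: "nat \<Rightarrow> 'a set" where U: "\<And>n. openin I (U n)" "\<And>n. U n \<noteq> {}"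
    and comp_iff: "\<And>x. x \<in> topspace I \<Longrightarrow> composant_of I x = {y. \<exists>n. (x, y) \<in> joined_off I (U n)}"
    using composant_of_countable_union[OF I(1)] by metis
  define R where "R n = joined_off I (U n)" for n
  have R: "closedin (prod_topology I I) (R n)" for n
    unfolding R_def by (rule closedin_joined_off[OF U(1)])
  have compR: "y \<in> composant_of I x \<longleftrightarrow> (\<exists>n. (x, y) \<in> R n)" if "x \<in> topspace I" for x y
    using comp_iff[OF that] by (simp add: R_def)
  obtain F :: "nat \<Rightarrow> 'a set" where F: "\<And>j. closedin I (F j)" "\<And>j. I interior_of (F j) = {}"
    and F_iff: "\<And>y. y \<in> topspace I \<Longrightarrow> (\<forall>j. y \<notin> F j) \<longleftrightarrow> composant_of I y \<subseteq> G"
    using composants_leaving_gdelta_meager[OF I P G] by metis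
  define \<Q> where "\<Q> = {Q. composant I Q \<and> Q \<subseteq> G}"
  have "infinite \<Q>"
    unfolding \<Q>_def by (rule infinite_composants_inside_comeager[OF I F F_iff])
  then obtain g :: "nat \<Rightarrow> 'a set" where g: "inj g" "range g \<subseteq> \<Q>"
    using infinite_countable_subset by blast
  (* Pairwise different composants label the nodes of the binary tree; the Cantor scheme takes the
     centre at each node from the composant that labels it. *)
  define c where "c s = g (to_nat s)" for s :: "bool list"
  have c: "c s \<in> \<Q>" for s using g by (auto simp: c_def)
  have c_comp: "c s = composant_of I y" if "y \<in> c s" for s y
    using c[of s] that composant_of_eq[OF I] unfolding \<Q>_def composant_def by blast
  obtain f :: "nat set \<Rightarrow> 'a" where f: "\<And>A. f A \<in> topspace I" "\<And>A n. f A \<notin> F n"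
    "\<And>A B n. A \<noteq> B \<Longrightarrow> (f A, f B) \<notin> R n"
  proof (rule Cantor_scheme_avoiding_relations[of R F c])
    note obtained = that
    show "compact_space mtopology" "closedin (prod_topology mtopology mtopology) (R n)"
      "closedin mtopology (F n)" "M \<noteq> {}" for n
      using comp R F ne by (simp_all only: M[symmetric] I_eq[symmetric] not_False_eq_True)
    show "c s \<subseteq> M" for s
      using c[of s] composant_subset_nonempty(1)[OF I(1)] unfolding \<Q>_def M by blast
    show "mtopology closure_of c s = M" for s
    proof -
      obtain x where x: "x \<in> topspace I" "c s = composant_of I x"
        using c[of s] unfolding \<Q>_def composant_def by blast
      show ?thesis
        using composant_of_dense[OF I(1) x(1)] unfolding x(2) M[symmetric] I_eq[symmetric] .
    qed
    show "c s \<inter> F n = {}" for s n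
    proof -
      have "y \<notin> F n" if "y \<in> c s" for y
        using F_iff[of y] c_comp[OF that] c[of s] composant_of_subset[of I y] that
        unfolding \<Q>_def by blast
      then show ?thesis by blast
    qed
    show "(x, y) \<notin> R n" if "s \<noteq> t" "x \<in> c s" "y \<in> c t" for s t x y n
    proof
      assume "(x, y) \<in> R n"
      moreover have "x \<in> topspace I"
        using c_comp[OF that(2)] that(2) composant_of_subset[of I x] by blast
      ultimately have "y \<in> c s"
        using compR c_comp[OF that(2)] by blast
      then have "c s = c t" using c_comp[of y s] c_comp[of y t] that(3) by blast
      then show False using that(1) g(1) by (simp add: c_def inj_eq)
    qed
    show thesis
      if "\<And>A. h A \<in> M" "\<And>A n. h A \<notin> F n" "\<And>A B n. A \<noteq> B \<Longrightarrow> (h A, h B) \<notin> R n" for h :: "nat set \<Rightarrow> 'a"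
      using obtained[of h] that by (simp add: M)
  qed
  show thesis
  proof (rule that[of f])
    show "composant_of I (f A) \<subseteq> G" for A using F_iff f by blast
    show "composant_of I (f A) \<inter> composant_of I (f B) = {}" if "A \<noteq> B" for A B
      using composants_disjoint[OF I] compR f that by meson
  qed (rule f(1))
qed

section \<open>Extending an embedding to an injection of a G-delta set\<close>

lemma gdelta_in_continuous_map_preimage:
  assumes f: "continuous_map X Y f" and B: "gdelta_in Y B"
  shows "gdelta_in X {x \<in> topspace X. f x \<in> B}"
proof -
  obtain C where C: "\<And>n. openin Y (C n)" "\<And>n::nat. C (Suc n) \<subseteq> C n" "\<Inter>(range C) = B"
    using B unfolding gdelta_in_descending by metis
  define D where "D n = {x \<in> topspace X. f x \<in> C n}" for n
  have "openin X (D n)" for n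
    unfolding D_def using f C(1) by (rule openin_continuous_map_preimage)
  moreover have "D (Suc n) \<subseteq> D n" for n
    using C(2) by (auto simp: D_def)
  moreover have "\<Inter>(range D) = {x \<in> topspace X. f x \<in> B}"
    unfolding C(3)[symmetric] by (auto simp: D_def)
  ultimately show ?thesis
    unfolding gdelta_in_descending by blast
qed

text \<open>
  Lavrentiev's theorem extends \<open>e\<close> to \<open>f\<close> and the inverse of \<open>e\<close> to \<open>h\<close>, each
  on a \<open>G\<^sub>\<delta>\<close> set.  The set of points \<open>x\<close> with \<open>h (f x) = x\<close> is again
  \<open>G\<^sub>\<delta>\<close>, contains \<open>P\<close>, and \<open>f\<close> is injective on it.
\<close>
lemma embedding_extends_to_injective_gdelta:
  assumes X: "completely_metrizable_space X" and Y: "completely_metrizable_space Y"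
    and P: "P \<subseteq> topspace X" and e: "embedding_map (subtopology X P) Y e"
  obtains G f where "gdelta_in X G" "P \<subseteq> G" "continuous_map (subtopology X G) Y f" "inj_on f G"
    "\<And>x. x \<in> P \<Longrightarrow> f x = e x"
proof -
  have mX: "metrizable_space X" and mY: "metrizable_space Y"
    using X Y by (simp_all add: completely_metrizable_imp_metrizable_space)
  have topP: "topspace (subtopology X P) = P" using P by auto
  obtain k where k: "homeomorphic_maps (subtopology X P) (subtopology Y (e ` P)) e k"
    using e unfolding embedding_map_def topP homeomorphic_map_maps by blast
  then have cont_e: "continuous_map (subtopology X P) Y e"
    and cont_k: "continuous_map (subtopology Y (e ` P)) X k"
    and ke: "\<And>x. x \<in> P \<Longrightarrow> k (e x) = x"
    unfolding homeomorphic_maps_def continuous_map_in_subtopology topP by blast+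
  have eP: "e ` P \<subseteq> topspace Y"
    using continuous_map_image_subset_topspace[OF cont_e] topP by simp
  obtain A f where A: "gdelta_in X A" "P \<subseteq> A" and f: "continuous_map (subtopology X A) Y f"
    and fe: "\<And>x. x \<in> P \<Longrightarrow> f x = e x"
    using Lavrentiev_extension[OF P disjI1[OF mX] Y cont_e] by metis
  obtain B h where B: "gdelta_in Y B" "e ` P \<subseteq> B" and h: "continuous_map (subtopology Y B) X h"
    and hk: "\<And>y. y \<in> e ` P \<Longrightarrow> h y = k y"
    using Lavrentiev_extension[OF eP disjI1[OF mY] X cont_k] by metis
  define A' where "A' = {x \<in> A. f x \<in> B}"
  have topA: "topspace (subtopology X A) = A"
    using gdelta_in_subset[OF A(1)] by auto
  have A': "gdelta_in X A'"
    using gdelta_in_continuous_map_preimage[OF f B(1)] gdelta_in_gdelta_subtopology[OF A(1)]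
    unfolding topA A'_def by blast
  define G where "G = {x \<in> A'. h (f x) = x}"
  have topA': "topspace (subtopology X A') = A'"
    using gdelta_in_subset[OF A'] by auto
  have "continuous_map (subtopology X A') (subtopology Y B) f"
    using continuous_map_from_subtopology_mono[OF f, of A'] topA'
    unfolding continuous_map_in_subtopology by (auto simp: A'_def)
  then have "continuous_map (subtopology X A') X (\<lambda>x. h (f x))"
    using continuous_map_compose[OF _ h] by (simp add: o_def)
  moreover have "continuous_map (subtopology X A') X (\<lambda>x. x)"
    by (simp add: continuous_map_from_subtopology)
  ultimately have "closedin (subtopology X A') G"
    using closedin_continuous_maps_eq[OF metrizable_imp_Hausdorff_space[OF mX]] topA'
    unfolding G_def by metis
  then have "gdelta_in X G"
    using closed_imp_gdelta_in[OF metrizable_space_subtopology[OF mX]]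
      gdelta_in_gdelta_subtopology[OF A'] by blast
  moreover have "P \<subseteq> G"
    using A(2) B(2) fe hk ke by (auto simp: G_def A'_def)
  moreover have "continuous_map (subtopology X G) Y f"
    using continuous_map_from_subtopology_mono[OF f, of G] by (auto simp: G_def A'_def)
  moreover have "inj_on f G"
    by (metis (mono_tags, lifting) G_def inj_onI mem_Collect_eq)
  ultimately show thesis
    using that fe by blast
qed

section \<open>Images of dense semicontinua\<close>

lemma subcontinuum_image:
  assumes X: "compact_space X" "connected_space X" "\<exists>x\<in>topspace X. \<exists>y\<in>topspace X. x \<noteq> y"
    and f: "continuous_map X Y f" "inj_on f (topspace X)" and Y: "metrizable_space Y"
  shows "subcontinuum Y (f ` topspace X)"
proof -
  have "compactin Y (f ` topspace X)" "connectedin Y (f ` topspace X)"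
    using X f compact_space_def connectedin_topspace connectedin_continuous_map_image image_compactin by metis+
  moreover have *: "\<exists>u\<in>f ` topspace X. \<exists>v\<in>f ` topspace X. u \<noteq> v"
    using X(3) f(2) unfolding inj_on_def by blast
  ultimately show ?thesis
    unfolding subcontinuum_def continuum_def
    using * Y by (simp add: compactin_subspace connectedin_def metrizable_space_subtopology Int_absorb1)
qed

lemma semicontinuum_image:
  assumes S: "semicontinuum (subtopology X S)" "S \<subseteq> topspace X"
    and f: "continuous_map (subtopology X S) Y f" "inj_on f S" and Y: "metrizable_space Y"
  shows "semicontinuum (subtopology Y (f ` S))"
  unfolding semicontinuum_def
proof (intro ballI)
  have top: "topspace (subtopology X S) = S" using S by auto
  fix u v assume "u \<in> topspace (subtopology Y (f ` S))" "v \<in> topspace (subtopology Y (f ` S))"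
  then obtain x y where xy: "x \<in> S" "u = f x" "y \<in> S" "v = f y" by auto
  then obtain C where C: "subcontinuum (subtopology X S) C" "x \<in> C" "y \<in> C"
    using S(1) unfolding semicontinuum_def top by blast
  let ?C = "subtopology X C"
  have CS: "C \<subseteq> S" and cC: "continuum ?C" and topC: "topspace ?C = C"
    using C(1) S(2) unfolding subcontinuum_def top
    by (auto simp: subtopology_subtopology Int_absorb1)
  have "continuous_map ?C (subtopology Y (f ` S)) f"
    using continuous_map_from_subtopology_mono[OF f(1) CS] CS topC
    unfolding continuous_map_in_subtopology by blast
  then have "subcontinuum (subtopology Y (f ` S)) (f ` C)"
    using subcontinuum_image[of ?C "subtopology Y (f ` S)" f] cC f(2) Y CS unfolding topC continuum_def
    by (meson inj_on_subset metrizable_space_subtopology)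
  then show "\<exists>D. subcontinuum (subtopology Y (f ` S)) D \<and> u \<in> D \<and> v \<in> D"
    using xy C by blast
qed

lemma dense_image_of_dense:
  assumes f: "continuous_map (subtopology X G) Y f" and G: "G \<subseteq> topspace X"
    and Q: "Q \<subseteq> G" "X closure_of Q = topspace X"
    and fG: "Y closure_of (f ` G) = topspace Y"
  shows "Y closure_of (f ` Q) = topspace Y"
proof -
  have "f ` (subtopology X G closure_of Q) \<subseteq> Y closure_of (f ` Q)"
    using f by (rule continuous_map_image_closure_subset)
  moreover have "subtopology X G closure_of Q = G"
    using Q G by (auto simp: closure_of_subtopology Int_absorb1)
  ultimately have "topspace Y \<subseteq> Y closure_of (f ` Q)"
    using fG by (metis closure_of_minimal closedin_closure_of)
  then show ?thesis
    by (simp add: closure_of_subset_topspace subset_antisym)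
qed

section \<open>Compactifications of a composant\<close>

text \<open>
  The semicontinua are the images of composants inside \<open>G\<close> under the extension \<open>f\<close> of \<open>e\<close>.
  They are dense since these composants are dense in \<open>G\<close> and \<open>f ` G\<close> contains \<open>e ` P\<close>, and
  disjoint since \<open>f\<close> is injective on all of \<open>G\<close>.
\<close>
lemma dense_semicontinua_of_dense_embedding:
  fixes I :: "'b topology" and Y :: "'d topology"
  assumes I: "continuum I" "indecomposable I" and P: "composant I P"
    and Y: "compact_space Y" "metrizable_space Y"
    and e: "embedding_map (subtopology I P) Y e" and dense: "Y closure_of (e ` P) = topspace Y"
  shows "\<exists>\<S>. \<S> \<approx> (UNIV :: real set) \<and> pairwise disjnt \<S> \<and> (\<forall>S\<in>\<S>. dense_semicontinuum_in Y S)"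
proof -
  have PI: "P \<subseteq> topspace I"
    using composant_subset_nonempty(1)[OF I(1) P] .
  have cm: "completely_metrizable_space I" "completely_metrizable_space Y"
    using I(1) Y unfolding continuum_def
    by (metis compact_imp_locally_compact_space locally_compact_imp_completely_metrizable_space)+
  obtain G f where G: "gdelta_in I G" "P \<subseteq> G" and f: "continuous_map (subtopology I G) Y f" "inj_on f G"
    and fe: "\<And>x. x \<in> P \<Longrightarrow> f x = e x"
    using embedding_extends_to_injective_gdelta[OF cm PI e] by metis
  have GI: "G \<subseteq> topspace I" using gdelta_in_subset[OF G(1)] .
  obtain h :: "nat set \<Rightarrow> 'b" where h: "\<And>A. h A \<in> topspace I" "\<And>A. composant_of I (h A) \<subseteq> G"
    "\<And>A B. A \<noteq> B \<Longrightarrow> composant_of I (h A) \<inter> composant_of I (h B) = {}"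
    using composants_inside_gdelta[OF I P G] by metis
  define S where "S A = f ` composant_of I (h A)" for A
  have hne: "composant_of I (h A) \<noteq> {}" for A
    using composant_of_refl[OF I(1) h(1)] by blast
  have disj: "S A \<inter> S B = {}" if "A \<noteq> B" for A B
    unfolding S_def using inj_on_image_Int[OF f(2) h(2) h(2), of A B] h(3)[OF that] by simp
  have "inj S"
    using disj hne by (metis S_def image_is_empty inf.idem injI)
  then have "range S \<approx> (UNIV :: nat set set)"
    by (rule inj_on_image_eqpoll_self)
  then have "range S \<approx> (UNIV :: real set)"
    using nat_sets_eqpoll_reals eqpoll_trans by blast
  moreover have "pairwise disjnt (range S)"
    using disj unfolding pairwise_def disjnt_def by (metis rangeE)
  moreover have "dense_semicontinuum_in Y (S A)" for A
  proof -
    have fG: "f ` G \<subseteq> topspace Y"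
      using continuous_map_image_subset_topspace[OF f(1)] GI by (auto simp: Int_absorb1)
    have "e ` P \<subseteq> f ` G" using fe G(2) by (metis image_cong image_mono)
    then have "Y closure_of (f ` G) = topspace Y"
      using dense closure_of_mono closure_of_subset_topspace by (metis subset_antisym)
    then have "Y closure_of S A = topspace Y"
      unfolding S_def
      by (rule dense_image_of_dense[OF f(1) GI h(2) composant_of_dense[OF I(1) h(1)]])
    moreover have "semicontinuum (subtopology Y (S A))"
      unfolding S_def
    proof (rule semicontinuum_image)
      show "semicontinuum (subtopology I (composant_of I (h A)))"
        by (rule semicontinuum_composant_of[OF I])
      show "composant_of I (h A) \<subseteq> topspace I" by (rule composant_of_subset)
      show "continuous_map (subtopology I (composant_of I (h A))) Y f"
        using f(1) h(2) by (rule continuous_map_from_subtopology_mono)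
      show "inj_on f (composant_of I (h A))" using f(2) h(2) by (rule inj_on_subset)
    qed (rule Y)
    moreover have "S A \<subseteq> topspace Y" using fG h(2) by (auto simp: S_def)
    ultimately show ?thesis by (simp add: dense_semicontinuum_in_def)
  qed
  ultimately show ?thesis by blast
qed

lemma not_suslinian_if_disjoint_semicontinua:
  assumes \<S>: "uncountable \<S>" "pairwise disjnt \<S>"
    and semi: "\<And>S. S \<in> \<S> \<Longrightarrow> S \<subseteq> topspace K \<and> S \<noteq> {} \<and> semicontinuum (subtopology K S)"
  shows "\<not> suslinian_continuum K"
proof -
  have "\<exists>C. subcontinuum K C \<and> C \<noteq> {} \<and> C \<subseteq> S" if S: "S \<in> \<S>" for S
  proof -
    obtain x where "x \<in> topspace (subtopology K S)"
      using semi[OF S] by auto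
    then obtain C where C: "subcontinuum (subtopology K S) C" "C \<noteq> {}"
      using semi[OF S] unfolding semicontinuum_def by blast
    then have "C \<subseteq> S" by (auto simp: subcontinuum_def)
    then have "subcontinuum K C"
      using C by (simp add: subcontinuum_def subtopology_subtopology Int_absorb1)
    with C \<open>C \<subseteq> S\<close> show ?thesis by blast
  qed
  then obtain c where c: "\<And>S. S \<in> \<S> \<Longrightarrow> subcontinuum K (c S) \<and> c S \<noteq> {} \<and> c S \<subseteq> S"
    by metis
  have dis: "disjnt (c S) (c T)" if "S \<in> \<S>" "T \<in> \<S>" "S \<noteq> T" for S T
    using \<S>(2) c that unfolding pairwise_def by (meson disjnt_subset1 disjnt_subset2)
  then have "inj_on c \<S>"
    using c by (metis disjnt_self_iff_empty inj_onI)
  then have "uncountable (c ` \<S>)"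
    using \<S>(1) by (simp add: countable_image_inj_eq)
  moreover have "pairwise disjnt (c ` \<S>)"
    using dis by (auto simp: pairwise_def)
  ultimately show ?thesis
    using c unfolding suslinian_continuum_def by blast
qed

lemma embedding_map_transport:
  assumes "X homeomorphic_space X'" "embedding_map X Y g"
  obtains e where "embedding_map X' Y e" "e ` topspace X' = g ` topspace X"
proof -
  have "X' homeomorphic_space X"
    using assms(1) by (rule homeomorphic_space_sym[THEN iffD1])
  then obtain h where h: "homeomorphic_map X' X h"
    unfolding homeomorphic_space by blast
  then have "embedding_map X' X h"
    unfolding embedding_map_def by (simp add: homeomorphic_imp_surjective_map)
  then have "embedding_map X' Y (g \<circ> h)"
    using assms(2) by (rule embedding_map_compose)
  moreover have "(g \<circ> h) ` topspace X' = g ` topspace X"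
    using homeomorphic_imp_surjective_map[OF h] by (metis image_comp)
  ultimately show thesis by (rule that)
qed

theorem theorem3:
  fixes X :: "'a topology" and I :: "'b topology" and P :: "'b set"
  assumes "sep_metrizable X"
    and "continuum I" and "indecomposable I"
    and "composant I P"
    and "X homeomorphic_space (subtopology I P)"
  shows "(\<forall>K :: 'c topology. suslinian_continuum K \<longrightarrow> \<not> (\<exists>f. embedding_map X K f)) \<and>
         (\<forall>(Y :: 'd topology) g. metrizable_space Y \<and> compactification X Y g \<longrightarrow>
            (\<exists>\<S>. \<S> \<approx> (UNIV :: real set) \<and> pairwise disjnt \<S> \<and>
                 (\<forall>S\<in>\<S>. dense_semicontinuum_in Y S)))"
proof (intro conjI allI impI notI)
  have PI: "P \<subseteq> topspace I" "P \<noteq> {}"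
    by (fact composant_subset_nonempty[OF assms(2,4)])+
  fix Y :: "'d topology" and g
  assume "metrizable_space Y \<and> compactification X Y g"
  then have Y: "compact_space Y" "metrizable_space Y" "embedding_map X Y g"
    "Y closure_of (g ` topspace X) = topspace Y"
    by (auto simp: compactification_def)
  obtain e where "embedding_map (subtopology I P) Y e" "e ` P = g ` topspace X"
    using embedding_map_transport[OF assms(5) Y(3)] PI by (auto simp: Int_absorb1)
  then show "\<exists>\<S>. \<S> \<approx> (UNIV :: real set) \<and> pairwise disjnt \<S> \<and>
      (\<forall>S\<in>\<S>. dense_semicontinuum_in Y S)"
    using dense_semicontinua_of_dense_embedding[OF assms(2-4) Y(1,2)] Y(4) by metis
next
  have PI: "P \<subseteq> topspace I" "P \<noteq> {}"
    by (fact composant_subset_nonempty[OF assms(2,4)])+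
  fix K :: "'c topology"
  assume K: "suslinian_continuum K" and "\<exists>f. embedding_map X K f"
  then obtain f where "embedding_map X K f" by blast
  then obtain e where e: "embedding_map (subtopology I P) K e"
    using embedding_map_transport[OF assms(5)] by metis
  define Z where "Z = K closure_of (e ` P)"
  define Y where "Y = subtopology K Z"
  have eP: "e ` P \<subseteq> topspace K"
  proof -
    have topP: "topspace (subtopology I P) = P" using PI by auto
    have "e ` P = topspace K \<inter> e ` P"
      using homeomorphic_imp_surjective_map[OF e[unfolded embedding_map_def]]
      unfolding topP by (simp only: topspace_subtopology)
    then show ?thesis by blast
  qed
  then have Z: "e ` P \<subseteq> Z" "Z \<subseteq> topspace K" "closedin K Z"
    by (simp_all add: Z_def closure_of_subset closure_of_subset_topspace)
  have "compact_space Y" "metrizable_space Y"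
    using K Z(3) unfolding Y_def suslinian_continuum_def continuum_def
    by (simp_all add: closedin_compact_space compact_space_subtopology metrizable_space_subtopology)
  moreover have "embedding_map (subtopology I P) Y e"
    using e Z(1) PI unfolding Y_def by (simp add: embedding_map_in_subtopology Int_absorb1)
  moreover have "Y closure_of (e ` P) = topspace Y"
    unfolding Y_def using Z by (simp add: closure_of_subtopology Int_absorb1 Int_absorb2 flip: Z_def)
  ultimately obtain \<S> where \<S>: "\<S> \<approx> (UNIV :: real set)" "pairwise disjnt \<S>"
    "\<And>S. S \<in> \<S> \<Longrightarrow> dense_semicontinuum_in Y S"
    using dense_semicontinua_of_dense_embedding[OF assms(2-4)] by metis
  have "uncountable \<S>"
    using countable_eqpoll[OF _ eqpoll_sym[OF \<S>(1)]] uncountable_UNIV_real by blast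
  moreover have "S \<subseteq> topspace K \<and> S \<noteq> {} \<and> semicontinuum (subtopology K S)" if "S \<in> \<S>" for S
  proof -
    have S: "S \<subseteq> Z" "semicontinuum (subtopology Y S)" "Y closure_of S = Z"
      using \<S>(3)[OF that] Z(2) by (auto simp: dense_semicontinuum_in_def Y_def Int_absorb1)
    have "S \<noteq> {}"
      using S(3) Z(1) PI(2) by auto
    moreover have "subtopology Y S = subtopology K S"
      using S(1) by (simp add: Y_def subtopology_subtopology Int_absorb1)
    ultimately show ?thesis
      using S(1,2) Z(2) by auto
  qed
  ultimately have "\<not> suslinian_continuum K"
    using not_suslinian_if_disjoint_semicontinua[OF _ \<S>(2)] by blast
  with K show False by blast
qed

end
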